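(* Let $m\ge1$. For $n\in\mathbb{Z}_+$ let $\boldsymbol a_n$ be a $1\times m$ complex vector, and define the vector series $\boldsymbol\phi(w)=\sum_{n=0}^\infty\boldsymbol a_nw^n$ for $w\in\mathbb{C}$. For an $m\times m$ complex matrix $X$ define $\boldsymbol\phi(X)=\sum_{n=0}^\infty\boldsymbol a_nX^n$. Assume that, for some $r>0$, $\boldsymbol\phi(w)$ converges absolutely for all $w\in\mathbb{C}$ with $|w|<r$. Then, if $\mathrm{spr}(X)<r$, $\boldsymbol\phi(X)$ also converges absolutely.
   Context: $\mathrm{spr}(X)$ is the spectral radius of $X$. Absolute convergence of a series of vectors is understood entry-wise: the series of the entry-wise moduli converges. *)

theory Defs
  imports "Jordan_Normal_Form.Spectral_Radius"
begin

(* Entry-wise absolute convergence of a series of nr x nc matrices. The dimensions are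
   parameters because the type of matrices does not determine them, and entries outside the
   dimensions are unspecified. *)
definition mat_abs_summable :: "nat \<Rightarrow> nat \<Rightarrow> (nat \<Rightarrow> complex mat) \<Rightarrow> bool" where
  "mat_abs_summable nr nc f \<longleftrightarrow>
     (\<forall>i<nr. \<forall>j<nc. summable (\<lambda>n. norm (f n $$ (i, j))))"

end

(* Rescaling X by a number s strictly between spr(X) and r gives spectral radius below 1, so the
   powers of X/s have bounded entries (Jordan normal form) and |X^n| <= c s^n entry-wise. Hence
   the series is dominated by the absolutely convergent phi(s). *)
theory Submission
  imports Defs
begin

lemma pow_smult_mat:
  fixes A :: "'a :: comm_semiring_1 mat"
  assumes A: "A \<in> carrier_mat n n"
  shows "(c \<cdot>\<^sub>m A) ^\<^sub>m k = c ^ k \<cdot>\<^sub>m (A ^\<^sub>m k)"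
proof (induction k)
  case 0
  show ?case using A by auto
next
  case (Suc k)
  have P: "A ^\<^sub>m k \<in> carrier_mat n n"
    using A by simp
  have "(c \<cdot>\<^sub>m A) ^\<^sub>m Suc k = (c ^ k \<cdot>\<^sub>m (A ^\<^sub>m k)) * (c \<cdot>\<^sub>m A)"
    using Suc by simp
  also have "\<dots> = c ^ k \<cdot>\<^sub>m (c \<cdot>\<^sub>m (A ^\<^sub>m k * A))"
    using mult_smult_assoc_mat[OF P, of "c \<cdot>\<^sub>m A" n] mult_smult_distrib[OF P A] A by simp
  also have "\<dots> = c ^ Suc k \<cdot>\<^sub>m (A ^\<^sub>m Suc k)"
    by (intro eq_matI) (simp_all add: ac_simps)
  finally show ?case .
qed

text \<open>An eigenvector of a matrix stays one after scaling, with the eigenvalue scaled alike.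
  The local fact \<open>scale\<close> allows any matrix and factor, so it yields both inclusions:
  one from \<open>A\<close> and \<open>c\<close>, the other from the scaled matrix and
  \<open>inverse c\<close>.\<close>

lemma spectrum_smult_mat:
  fixes A :: "'a :: field mat"
  assumes A: "A \<in> carrier_mat n n" and c: "c \<noteq> 0"
  shows "spectrum (c \<cdot>\<^sub>m A) = (*) c ` spectrum A"
proof -
  have scale: "e * d \<in> spectrum (d \<cdot>\<^sub>m B)"
    if B: "B \<in> carrier_mat n n" and "e \<in> spectrum B" for B :: "'a mat" and d e
  proof -
    from that obtain v where v: "eigenvector B v e"
      by (auto simp: spectrum_def eigenvalue_def)
    have "(d \<cdot>\<^sub>m B) *\<^sub>v v = (e * d) \<cdot>\<^sub>v v"
    proof -
      have v_dim: "v \<in> carrier_vec n"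
        using v B by (simp add: eigenvector_def)
      have "(d \<cdot>\<^sub>m B) *\<^sub>v v = d \<cdot>\<^sub>v (B *\<^sub>v v)"
        using B v_dim by (intro eq_vecI) auto
      with v show ?thesis
        by (simp add: eigenvector_def smult_smult_assoc mult.commute)
    qed
    with v B show ?thesis
      by (auto simp: spectrum_def eigenvalue_def eigenvector_def)
  qed
  have inv: "inverse c \<cdot>\<^sub>m (c \<cdot>\<^sub>m A) = A"
    using c by (intro eq_matI) auto
  show ?thesis
  proof (intro equalityI subsetI)
    fix e assume "e \<in> spectrum (c \<cdot>\<^sub>m A)"
    with scale[of "c \<cdot>\<^sub>m A" e "inverse c"] A have "e * inverse c \<in> spectrum A"
      by (simp add: inv)
    moreover have "e = c * (e * inverse c)"
      using c by simp
    ultimately show "e \<in> (*) c ` spectrum A"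
      by blast
  next
    fix e assume "e \<in> (*) c ` spectrum A"
    with scale[OF A] show "e \<in> spectrum (c \<cdot>\<^sub>m A)"
      by (auto simp: mult.commute)
  qed
qed

text \<open>The strict inequality leaves room for the polynomial factors in \<open>k\<close> that
  nontrivial Jordan blocks contribute; with \<open>s\<close> equal to the spectral radius no
  constant \<open>c\<close> would do in general.\<close>

lemma pow_mat_norm_bound_spectral_radius:
  assumes A: "A \<in> carrier_mat n n" and n: "n > 0" and s: "spectral_radius A < s" "s > 0"
  obtains c where "\<And>k. norm_bound (A ^\<^sub>m k) (c * s ^ k)"
proof -
  define d where "d = complex_of_real (inverse s)"
  have d: "d \<noteq> 0" "norm d = inverse s"
    using s by (simp_all add: d_def norm_inverse)
  have dA: "d \<cdot>\<^sub>m A \<in> carrier_mat n n"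
    using A by simp
  \<comment> \<open>Since \<open>n > 0\<close>, the spectrum is nonempty and the maximum is
    attained. Tracing the maximal eigenvalue back to an eigenvalue \<open>f\<close> of
    \<open>A\<close> gives the modulus \<open>norm f / s\<close>, which is below 1.\<close>
  obtain e where e: "e \<in> spectrum (d \<cdot>\<^sub>m A)" "spectral_radius (d \<cdot>\<^sub>m A) = norm e"
    using spectral_radius_mem_max(1)[OF dA n] by auto
  then obtain f where f: "f \<in> spectrum A" "e = d * f"
    using spectrum_smult_mat[OF A d(1)] by auto
  have "norm f < s"
    using spectral_radius_mem_max(2)[OF A n, of "norm f"] f s by auto
  then have "spectral_radius (d \<cdot>\<^sub>m A) < 1"
    using s by (simp add: e f d norm_mult field_simps)
  from spectral_radius_jnf_norm_bound_less_1_upper_triangular[OF dA this]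
  obtain c where c: "\<And>k. norm_bound ((d \<cdot>\<^sub>m A) ^\<^sub>m k) c"
    by blast
  have "norm_bound (A ^\<^sub>m k) (c * s ^ k)" for k
    unfolding norm_bound_def
  proof (intro allI impI)
    fix i j assume ij: "i < dim_row (A ^\<^sub>m k)" "j < dim_col (A ^\<^sub>m k)"
    \<comment> \<open>Each entry of the rescaled power is the entry of \<open>A ^\<^sub>m k\<close>
      times \<open>d ^ k\<close>, of modulus \<open>s\<close> to the power \<open>-k\<close>;
      multiplying by \<open>s ^ k\<close> undoes the scaling.\<close>
    have "norm (((d \<cdot>\<^sub>m A) ^\<^sub>m k) $$ (i, j)) \<le> c"
      using c[of k] ij A unfolding norm_bound_def pow_smult_mat[OF A] by simp
    then show "norm ((A ^\<^sub>m k) $$ (i, j)) \<le> c * s ^ k"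
      using ij s unfolding pow_smult_mat[OF A]
      by (simp add: norm_mult norm_power d power_inverse field_simps)
  qed
  then show ?thesis
    by (rule that)
qed

theorem lemma3p2:
  fixes m :: nat and a :: "nat \<Rightarrow> complex mat" and X :: "complex mat" and r :: real
  assumes "m \<ge> 1"
    and "\<And>n. a n \<in> carrier_mat 1 m"
    and "X \<in> carrier_mat m m"
    and "r > 0"
    and "\<And>w::complex. norm w < r \<Longrightarrow> mat_abs_summable 1 m (\<lambda>n. w ^ n \<cdot>\<^sub>m a n)"
    and "spectral_radius X < r"
  shows "mat_abs_summable 1 m (\<lambda>n. a n * X ^\<^sub>m n)"
proof -
  note a = assms(2) and X = assms(3)
  \<comment> \<open>The maximum with 0 keeps \<open>s\<close> positive even for nilpotent
    \<open>X\<close>, whose spectral radius is 0, so that dividing by \<open>s\<close> is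
    legitimate.\<close>
  obtain s where s: "max 0 (spectral_radius X) < s" "s < r"
    using dense[of "max 0 (spectral_radius X)" r] assms(4,6) by auto
  obtain c where c: "\<And>k. norm_bound (X ^\<^sub>m k) (c * s ^ k)"
    using pow_mat_norm_bound_spectral_radius[OF X, of s] assms(1) s by auto
  have "mat_abs_summable 1 m (\<lambda>n. complex_of_real s ^ n \<cdot>\<^sub>m a n)"
    using assms(5)[of "complex_of_real s"] s by simp
  moreover have "norm ((complex_of_real s ^ n \<cdot>\<^sub>m a n) $$ (0, l)) = norm (a n $$ (0, l)) * s ^ n"
    if "l < m" for n l
    using a[of n] s that by (simp add: norm_mult norm_power)
  ultimately have scaled: "summable (\<lambda>n. norm (a n $$ (0, l)) * s ^ n)" if "l < m" for l
    using that by (simp add: mat_abs_summable_def)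
  have "summable (\<lambda>n. norm ((a n * X ^\<^sub>m n) $$ (0, j)))" if j: "j < m" for j
  proof (rule summable_comparison_test')
    \<comment> \<open>For a fixed column \<open>j\<close> the majorant is a finite combination of
      the \<open>m\<close> convergent series in \<open>scaled\<close>, because \<open>c\<close>
      depends on neither \<open>n\<close> nor \<open>l\<close>.\<close>
    show "summable (\<lambda>n. \<Sum>l<m. c * (norm (a n $$ (0, l)) * s ^ n))"
      by (intro summable_sum summable_mult scaled) simp
  next
    fix n
    have P: "X ^\<^sub>m n \<in> carrier_mat m m"
      using X by simp
    have "(a n * X ^\<^sub>m n) $$ (0, j) = (\<Sum>l<m. a n $$ (0, l) * (X ^\<^sub>m n) $$ (l, j))"
      using carrier_matD[OF a[of n]] carrier_matD[OF P] j
      by (simp add: scalar_prod_def atLeast0LessThan)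
    also have "norm \<dots> \<le> (\<Sum>l<m. norm (a n $$ (0, l)) * norm ((X ^\<^sub>m n) $$ (l, j)))"
      by (rule sum_norm_le) (simp add: norm_mult)
    also have "\<dots> \<le> (\<Sum>l<m. norm (a n $$ (0, l)) * (c * s ^ n))"
      using c[of n] carrier_matD[OF X] j unfolding norm_bound_def
      by (intro sum_mono mult_left_mono) auto
    \<comment> \<open>The outer norm comes from the comparison test, whose terms are already norms
      here.\<close>
    finally show "norm (norm ((a n * X ^\<^sub>m n) $$ (0, j)))
        \<le> (\<Sum>l<m. c * (norm (a n $$ (0, l)) * s ^ n))"
      by (simp add: ac_simps)
  qed
  then show ?thesis
    by (simp add: mat_abs_summable_def)
qed

end
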